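(* Let $\gamma_1(t)$ and $\gamma_2(t)$ be two $C^\infty$ curves in the affine plane $\mathbb{R}^2$, each having a $3/2$-cusp at $t=0$. Then $\gamma_1$ and $\gamma_2$ have the same affine cuspidal curvature $\mu_A$ at $t=0$ if and only if there exist an equi-affine transformation $T$ of $\mathbb{R}^2$ and a parametrization $u=u(t)$ near $t=0$ (with $u(0)=0$) such that $du/dt>0$ and $|T\circ\gamma_2\circ u(t)-\gamma_1(t)|$ has order higher than $t^5$ (i.e. is $o(t^5)$ as $t\to0$).
   Context: For $\mathbf a,\mathbf b\in\mathbb{R}^2$, $[\mathbf a,\mathbf b]=a_1b_2-a_2b_1$. A $C^\infty$ curve $\gamma$ has a $3/2$-cusp at $t=0$ if after a suitable coordinate change of the parameter and a local diffeomorphism of $\mathbb{R}^2$ at $\gamma(0)$ it becomes $t\mapsto(t^2,t^3)$; equivalently, $\dot\gamma(0)=0$ and $[\ddot\gamma(0),\gamma^{(3)}(0)]\neq0$. An equi-affine transformation of $\mathbb{R}^2$ is an affine transformation whose Jacobian is $\pm1$ with respect to the canonical coordinates. The affine cuspidal curvature of $\gamma$ at a $3/2$-cusp $t=0$ is $$\mu_A=\left.\frac{24[\ddot\gamma,\gamma^{(3)}]\,[\ddot\gamma,\gamma^{(5)}]+60[\ddot\gamma,\gamma^{(3)}]\,[\gamma^{(3)},\gamma^{(4)}]-35[\ddot\gamma,\gamma^{(4)}]^2}{\bigl|[\ddot\gamma,\gamma^{(3)}]\bigr|^{12/5}}\right|_{t=0}.$$ *)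

theory Defs
  imports "HOL-Analysis.Analysis" "HOL-Library.Landau_Symbols"
begin

text \<open>Intended for open \<open>S\<close>: all iterated directional derivatives up to order \<open>k\<close> exist
  and are continuous on \<open>S\<close>.\<close>

primrec Ck_on :: "nat \<Rightarrow> 'a::euclidean_space set \<Rightarrow> ('a \<Rightarrow> 'b::euclidean_space) \<Rightarrow> bool" where
  "Ck_on 0 S f \<longleftrightarrow> continuous_on S f"
| "Ck_on (Suc k) S f \<longleftrightarrow>
     (\<forall>x\<in>S. f differentiable (at x)) \<and>
     (\<forall>v. Ck_on k S (\<lambda>x. frechet_derivative f (at x) v))"

definition smooth_on :: "'a::euclidean_space set \<Rightarrow> ('a \<Rightarrow> 'b::euclidean_space) \<Rightarrow> bool" where
  "smooth_on S f \<longleftrightarrow> (\<forall>k. Ck_on k S f)"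

definition smooth_diffeo ::
    "'a::euclidean_space set \<Rightarrow> 'a set \<Rightarrow> ('a \<Rightarrow> 'a) \<Rightarrow> bool" where
  "smooth_diffeo U V f \<longleftrightarrow>
     open U \<and> open V \<and> smooth_on U f \<and>
     (\<exists>g. homeomorphism U V f g \<and> smooth_on V g)"

definition open_interval_at_0 :: "real set \<Rightarrow> bool" where
  "open_interval_at_0 I \<longleftrightarrow> open I \<and> is_interval I \<and> 0 \<in> I"

definition curve_deriv :: "nat \<Rightarrow> (real \<Rightarrow> real^2) \<Rightarrow> real \<Rightarrow> real^2" where
  "curve_deriv n \<gamma> = ((\<lambda>f t. vector_derivative f (at t)) ^^ n) \<gamma>"

definition bracket :: "real^2 \<Rightarrow> real^2 \<Rightarrow> real" where
  "bracket a b = a $ 1 * b $ 2 - a $ 2 * b $ 1"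

text \<open>The parameter change \<open>s\<close> may reverse orientation. Since \<open>s\<close> fixes \<open>0\<close>, the set \<open>J\<close> can be
  shrunk so that \<open>s\<close> maps it into any given neighbourhood of \<open>0\<close> on which \<open>\<gamma>\<close> is
  defined, so no domain of \<open>\<gamma>\<close> needs to be mentioned.\<close>

definition has_cusp_3_2_at_0 :: "(real \<Rightarrow> real^2) \<Rightarrow> bool" where
  "has_cusp_3_2_at_0 \<gamma> \<longleftrightarrow>
     (\<exists>J K s U V \<Phi>.
        smooth_diffeo J K s \<and> 0 \<in> J \<and> s 0 = (0::real) \<and>
        smooth_diffeo U V \<Phi> \<and> \<gamma> 0 \<in> U \<and>
        (\<forall>t\<in>J. \<gamma> (s t) \<in> U \<and> \<Phi> (\<gamma> (s t)) = vector [t ^ 2, t ^ 3]))"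

definition affine_cuspidal_curvature :: "(real \<Rightarrow> real^2) \<Rightarrow> real" where
  "affine_cuspidal_curvature \<gamma> =
     (let d = (\<lambda>n. curve_deriv n \<gamma> 0) in
      (24 * bracket (d 2) (d 3) * bracket (d 2) (d 5)
       + 60 * bracket (d 2) (d 3) * bracket (d 3) (d 4)
       - 35 * (bracket (d 2) (d 4)) ^ 2)
      / \<bar>bracket (d 2) (d 3)\<bar> powr (12 / 5))"

definition equi_affine :: "(real^2 \<Rightarrow> real^2) \<Rightarrow> bool" where
  "equi_affine T \<longleftrightarrow>
     (\<exists>(A::real^2^2) b. \<bar>det A\<bar> = 1 \<and> T = (\<lambda>x. A *v x + b))"

end

theory Submission
  imports Defs "HOL-Computational_Algebra.Polynomial"
begin

text \<open>
  Whether two curves agree up to \<open>o(t\<^sup>5)\<close> depends only on their fifth-order Taylor polynomials, so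
  the theorem is a statement about the derivative vectors \<open>d 2, \<dots>, d 5\<close> at the cusp: the first
  derivative vanishes there, and the constant term is absorbed by a translation.

  A parameter change \<open>u(t) = u\<^sub>1 t + u\<^sub>2 t\<^sup>2 + u\<^sub>3 t\<^sup>3 + u\<^sub>4 t\<^sup>4 + \<dots>\<close> replaces the vectors \<open>d k\<close> by
  explicit combinations \<open>e k\<close> of them (\<open>reparam_jet\<close>). The numerator of the affine cuspidal curvature,
  as a polynomial in these vectors, does not see \<open>u\<^sub>2, u\<^sub>3, u\<^sub>4\<close> at all and is multiplied by
  \<open>u\<^sub>1\<^sup>1\<^sup>2\<close> (\<open>cusp_numerator_reparam\<close>), while \<open>[d 2, d 3]\<close> is multiplied by \<open>u\<^sub>1\<^sup>5\<close>; the exponent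
  \<open>12/5\<close> balances the two. A linear map of determinant \<open>\<plusminus>1\<close> changes all brackets by the same sign,
  which disappears because the numerator is quadratic in brackets. This is the invariance of the
  curvature.

  Conversely (\<open>reparam_exists\<close>), let the curvatures agree. A linear map \<open>A\<close> sending the frame
  \<open>e 2, e 3\<close> to \<open>D 2, D 3\<close> always exists, and it has determinant \<open>\<plusminus>1\<close> for exactly one \<open>u\<^sub>1 > 0\<close>.
  It sends \<open>e 4, e 5\<close> to \<open>D 4, D 5\<close> iff four bracket equations hold. Three of them are linear in
  \<open>u\<^sub>2\<close>, \<open>u\<^sub>3\<close> and \<open>u\<^sub>4\<close> in turn, with nonzero coefficient, so they can be solved; the fourth is then
  precisely the equality of the curvatures.

  The passage between functions and vectors uses polynomial jets, which multiply and compose like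
  polynomials and have unique coefficients. The same calculus shows that the definition of a cusp by
  coordinate changes forces \<open>d 1 = 0\<close> and \<open>[d 2, d 3] \<noteq> 0\<close> (\<open>cusp_derivatives\<close>): the curve is, up to
  a parameter change, the image of \<open>(t\<^sup>2, t\<^sup>3)\<close> under a local diffeomorphism, whose quadratic
  remainder at the origin is only \<open>O(t\<^sup>4)\<close>.
\<close>

section \<open>Jets of real functions at the origin\<close>

text \<open>The filter is \<open>nhds 0\<close> rather than \<open>at 0\<close> so that a jet of \<open>f\<close> may be substituted along any
  \<open>u\<close> tending to \<open>0\<close>, even one that takes the value \<open>0\<close> elsewhere. The polynomial is not
  truncated: only its coefficients up to \<open>n\<close> are determined by \<open>f\<close>.\<close>

definition jet :: "nat \<Rightarrow> (real \<Rightarrow> real) \<Rightarrow> real poly \<Rightarrow> bool" where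
  "jet n f p \<longleftrightarrow> (\<lambda>t. f t - poly p t) \<in> o[nhds 0](\<lambda>t. t ^ n)"

lemma power_bigo_1: "(\<lambda>t::real. t ^ n) \<in> O[nhds 0](\<lambda>_. 1)"
proof (rule bigoI_tendsto)
  show "((\<lambda>t::real. t ^ n / 1) \<longlongrightarrow> 0 ^ n) (nhds 0)"
    by (auto intro!: tendsto_eq_intros filterlim_ident)
qed auto

lemma poly_bigo_1: "poly (p :: real poly) \<in> O[nhds 0](\<lambda>_. 1)"
proof (rule bigoI_tendsto)
  show "((\<lambda>t::real. poly p t / 1) \<longlongrightarrow> poly p 0) (nhds 0)"
    by (auto intro!: tendsto_eq_intros filterlim_ident)
qed auto

text \<open>Dividing by \<open>t\<close> lowers the order by one and shifts the coefficients, so the constant terms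
  vanish one after the other.\<close>

lemma poly_smallo_coeff:
  fixes p :: "real poly"
  assumes "poly p \<in> o[at 0](\<lambda>t. t ^ n)" "k \<le> n"
  shows "coeff p k = 0"
  using assms
proof (induction n arbitrary: p k)
  case 0
  have "((\<lambda>t. poly p t / t ^ 0) \<longlongrightarrow> 0) (at 0)"
    by (rule smalloD_tendsto[OF 0(1)])
  moreover have "((\<lambda>t. poly p t / t ^ 0) \<longlongrightarrow> poly p 0) (at 0)"
    by (auto intro!: tendsto_eq_intros)
  ultimately have "poly p 0 = 0"
    using tendsto_unique trivial_limit_at by blast
  then show ?case using 0 by (simp add: poly_0_coeff_0)
next
  case (Suc n)
  obtain a r where p: "p = pCons a r" by (cases p)
  have "((\<lambda>t. (poly p t / t ^ Suc n) * t ^ Suc n) \<longlongrightarrow> 0 * 0 ^ Suc n) (at 0)"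
    by (intro tendsto_mult smalloD_tendsto[OF Suc.prems(1)]) (auto intro!: tendsto_eq_intros)
  then have "((\<lambda>t. (poly p t / t ^ Suc n) * t ^ Suc n) \<longlongrightarrow> 0) (at 0)" by simp
  then have "(poly p \<longlongrightarrow> 0) (at 0)"
    by (rule Lim_transform_eventually) (auto simp: eventually_at_filter)
  moreover have "(poly p \<longlongrightarrow> poly p 0) (at 0)"
    by (auto intro!: tendsto_eq_intros)
  ultimately have "poly p 0 = 0"
    using tendsto_unique trivial_limit_at by blast
  then have a: "a = 0" by (simp add: p)
  have "((\<lambda>t. poly p t / t ^ Suc n) \<longlongrightarrow> 0) (at 0)"
    by (rule smalloD_tendsto[OF Suc.prems(1)])
  then have "((\<lambda>t. poly r t / t ^ n) \<longlongrightarrow> 0) (at 0)"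
    by (rule Lim_transform_eventually) (auto simp: eventually_at_filter p a)
  then have r: "poly r \<in> o[at 0](\<lambda>t. t ^ n)"
    by (rule smalloI_tendsto) (rule eventually_mono[OF eventually_neq_at_within[of 0]], simp)
  show ?case
    using Suc.IH[OF r] Suc.prems(2) by (cases k) (auto simp: p a)
qed

lemma jet_at: "jet n f p \<Longrightarrow> (\<lambda>t. f t - poly p t) \<in> o[at 0](\<lambda>t. t ^ n)"
  unfolding jet_def by (rule landau_o.small.filter_mono[rotated]) (auto simp: at_within_def)

lemma jet_coeff_unique:
  assumes "jet n f p" "jet n g q" "(\<lambda>t. f t - g t) \<in> o[at 0](\<lambda>t. t ^ n)" "k \<le> n"
  shows "coeff p k = coeff q k"
proof -
  have "(\<lambda>t. (f t - g t) - (f t - poly p t) + (g t - poly q t)) \<in> o[at 0](\<lambda>t. t ^ n)"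
    by (intro sum_in_smallo jet_at assms)
  moreover have "(\<lambda>t. (f t - g t) - (f t - poly p t) + (g t - poly q t)) = poly (p - q)"
    by auto
  ultimately show ?thesis
    using poly_smallo_coeff[of "p - q" n k] assms(4) by simp
qed

lemma jet_smallo:
  assumes "jet n f p" "jet n g q" "\<And>k. k \<le> n \<Longrightarrow> coeff p k = coeff q k"
  shows "(\<lambda>t. f t - g t) \<in> o[at 0](\<lambda>t. t ^ n)"
proof -
  \<comment> \<open>The difference of the two polynomials is a multiple of \<open>t\<^sup>n\<^sup>+\<^sup>1\<close>.\<close>
  have "\<forall>k<Suc n. coeff (p - q) k = 0" using assms(3) by simp
  then have "monom 1 (Suc n) dvd p - q" by (simp add: monom_1_dvd_iff')
  then obtain r where r: "p - q = monom 1 (Suc n) * r" by (elim dvdE)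
  have "poly p t - poly q t = t ^ n * (t * poly r t)" for t
    using arg_cong[OF r, of "\<lambda>p. poly p t"] by (simp add: poly_monom mult_ac)
  moreover have "(\<lambda>t. t ^ n * (t * poly r t)) \<in> o[at 0](\<lambda>t. t ^ n * 1)"
  proof (rule landau_o.big_small_mult)
    show "(\<lambda>t. t * poly r t) \<in> o[at 0](\<lambda>_. 1)"
      by (rule smalloI_tendsto) (auto intro!: tendsto_eq_intros)
  qed auto
  ultimately have "(\<lambda>t. poly p t - poly q t) \<in> o[at 0](\<lambda>t. t ^ n)" by simp
  from sum_in_smallo(2)[OF sum_in_smallo(1)[OF this jet_at[OF assms(1)]] jet_at[OF assms(2)]]
  show ?thesis by simp
qed

lemma jet_poly: "jet n (poly p) p"
  by (simp add: jet_def)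

lemma jet_const: "jet n (\<lambda>_. c) [:c:]"
  by (simp add: jet_def)

lemma jet_add: "jet n f p \<Longrightarrow> jet n g q \<Longrightarrow> jet n (\<lambda>t. f t + g t) (p + q)"
  unfolding jet_def using sum_in_smallo(1)[of "\<lambda>t. f t - poly p t" "nhds 0" "\<lambda>t. t ^ n" "\<lambda>t. g t - poly q t"]
  by (simp add: algebra_simps)

lemma jet_bigo_1:
  assumes "jet n f p" shows "f \<in> O[nhds 0](\<lambda>_. 1)"
proof -
  have "(\<lambda>t. f t - poly p t) \<in> O[nhds 0](\<lambda>_. 1)"
    using assms landau_o.small_imp_big landau_o.big_trans power_bigo_1 unfolding jet_def by blast
  from sum_in_bigo(1)[OF this poly_bigo_1[of p]] show ?thesis by simp
qed

lemma jet_mult: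
  assumes "jet n f p" "jet n g q"
  shows "jet n (\<lambda>t. f t * g t) (p * q)"
proof -
  have "(\<lambda>t. (f t - poly p t) * g t) \<in> o[nhds 0](\<lambda>t. t ^ n * 1)"
    using assms jet_bigo_1 unfolding jet_def by (intro landau_o.small_big_mult)
  moreover have "(\<lambda>t. (g t - poly q t) * poly p t) \<in> o[nhds 0](\<lambda>t. t ^ n * 1)"
    using assms poly_bigo_1 unfolding jet_def by (intro landau_o.small_big_mult)
  ultimately have "(\<lambda>t. (f t - poly p t) * g t + (g t - poly q t) * poly p t) \<in> o[nhds 0](\<lambda>t. t ^ n)"
    using sum_in_smallo(1) by fastforce
  then show ?thesis by (simp add: jet_def algebra_simps)
qed

text \<open>The error \<open>o(u\<^sup>n)\<close> of \<open>f\<close> at \<open>u(t)\<close> is \<open>o(t\<^sup>n)\<close> because \<open>u = O(t)\<close>; evaluating the polynomial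
  \<open>p\<close> at \<open>u\<close> only involves sums and products of jets.\<close>

lemma jet_pcompose:
  assumes "jet n f p" "jet n u q" "n \<ge> 1" "coeff q 0 = 0"
  shows "jet n (\<lambda>t. f (u t)) (pcompose p q)"
proof -
  obtain r where q: "q = pCons 0 r" using assms(4) by (cases q) auto
  have "(\<lambda>t::real. t * t ^ (n - 1)) \<in> O[nhds 0](\<lambda>t. t * 1)"
    by (intro landau_o.big.mult power_bigo_1) auto
  then have tn: "(\<lambda>t::real. t ^ n) \<in> O[nhds 0](\<lambda>t. t)"
    using assms(3) by (simp add: power_eq_if)
  have "(\<lambda>t. u t - poly q t) \<in> O[nhds 0](\<lambda>t. t)"
    using assms(2) tn landau_o.small_imp_big landau_o.big_trans unfolding jet_def by blast
  moreover have "(\<lambda>t. t * poly r t) \<in> O[nhds 0](\<lambda>t. t * 1)"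
    by (intro landau_o.big.mult poly_bigo_1) auto
  ultimately have "(\<lambda>t. (u t - poly q t) + t * poly r t) \<in> O[nhds 0](\<lambda>t. t)"
    using sum_in_bigo(1) by fastforce
  then have ut: "u \<in> O[nhds 0](\<lambda>t. t)" by (simp add: q)
  then obtain c where c: "eventually (\<lambda>t. norm (u t) \<le> c * norm t) (nhds 0)"
    by (auto elim: landau_o.bigE)
  have "(u \<longlongrightarrow> 0) (nhds 0)"
    by (rule Lim_null_comparison[OF c]) (auto intro!: tendsto_eq_intros filterlim_ident)
  then have "(\<lambda>t. f (u t) - poly p (u t)) \<in> o[nhds 0](\<lambda>t. u t ^ n)"
    using landau_o.small.compose[of "\<lambda>t. f t - poly p t" "nhds 0" "\<lambda>t. t ^ n" u "nhds 0"] assms(1)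
    unfolding jet_def by simp
  moreover have "(\<lambda>t. u t ^ n) \<in> O[nhds 0](\<lambda>t. t ^ n)"
    using ut by (rule landau_o.big_power)
  ultimately have *: "(\<lambda>t. f (u t) - poly p (u t)) \<in> o[nhds 0](\<lambda>t. t ^ n)"
    by (rule landau_o.small_big_trans)
  have "jet n (\<lambda>t. poly p (u t)) (pcompose p q)" for p
  proof (induction p)
    case 0 then show ?case using jet_const[of n 0] by simp
  next
    case (pCons a p)
    from jet_add[OF jet_const[of n a] jet_mult[OF assms(2) pCons(2)]]
    show ?case by (simp add: pcompose_pCons)
  qed
  from sum_in_smallo(1)[OF * this[of p, unfolded jet_def]] show ?thesis
    by (simp add: jet_def)
qed

lemma smallo_nhds_0:
  fixes f g :: "real \<Rightarrow> real"
  assumes "f \<in> o[at 0](g)" "f 0 = 0"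
  shows "f \<in> o[nhds 0](g)"
proof (rule landau_o.smallI)
  fix c :: real assume c: "c > 0"
  have "eventually (\<lambda>t. norm (f t) \<le> c * norm (g t)) (at 0)"
    by (rule landau_o.smallD[OF assms(1) c])
  then have "eventually (\<lambda>t. t \<noteq> 0 \<longrightarrow> norm (f t) \<le> c * norm (g t)) (nhds 0)"
    by (simp add: eventually_at_filter)
  then show "eventually (\<lambda>t. norm (f t) \<le> c * norm (g t)) (nhds 0)"
    by eventually_elim (use assms(2) c in auto)
qed

lemma jet_0_isCont:
  assumes "isCont f 0" shows "jet 0 f [:f 0:]"
  unfolding jet_def
proof (rule smallo_nhds_0)
  have "((\<lambda>t. f t - f 0) \<longlongrightarrow> 0) (at 0)"
    using assms by (simp add: isCont_def LIM_zero_iff)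
  then show "(\<lambda>t. f t - poly [:f 0:] t) \<in> o[at 0](\<lambda>t. t ^ 0)"
    by (intro smalloI_tendsto) auto
qed auto

lemma jet_1_deriv:
  assumes "(f has_real_derivative c) (at 0)" shows "jet 1 f [:f 0, c:]"
  unfolding jet_def
proof (rule smallo_nhds_0)
  have "((\<lambda>t. (f t - f 0) / t - c) \<longlongrightarrow> 0) (at 0)"
    using assms by (simp add: DERIV_def LIM_zero_iff)
  then have "((\<lambda>t. (f t - poly [:f 0, c:] t) / t ^ 1) \<longlongrightarrow> 0) (at 0)"
    by (rule Lim_transform_eventually) (auto simp: eventually_at_filter field_simps)
  then show "(\<lambda>t. f t - poly [:f 0, c:] t) \<in> o[at 0](\<lambda>t. t ^ 1)"
    by (rule smalloI_tendsto) (auto simp: eventually_at_filter)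
qed auto

text \<open>By the mean value theorem, an error \<open>o(t\<^sup>n)\<close> of the derivative integrates to an error
  \<open>o(t\<^sup>n\<^sup>+\<^sup>1)\<close>.
  Iterated, this yields Taylor's formula below.\<close>

lemma jet_integrate:
  assumes "eventually (\<lambda>t. (f has_real_derivative f' t) (at t)) (nhds 0)"
    and "jet n f' (pderiv p)" and "f 0 = poly p 0"
  shows "jet (Suc n) f p"
  unfolding jet_def
proof (rule landau_o.smallI)
  fix c :: real assume "c > 0"
  then have "eventually (\<lambda>t. norm (f' t - poly (pderiv p) t) \<le> c * norm (t ^ n)) (nhds 0)"
    using assms(2) unfolding jet_def by (rule landau_o.smallD[rotated])
  from eventually_conj[OF this assms(1)] obtain d where d: "d > 0"
    and b: "\<And>t. dist t 0 < d \<Longrightarrow> norm (f' t - poly (pderiv p) t) \<le> c * norm (t ^ n)"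
    and f': "\<And>t. dist t 0 < d \<Longrightarrow> (f has_real_derivative f' t) (at t)"
    unfolding eventually_nhds_metric by blast
  have "norm (f t - poly p t) \<le> c * norm (t ^ Suc n)" if t: "dist t 0 < d" for t
  proof -
    let ?S = "cball 0 \<bar>t\<bar>"
    have "norm ((f t - poly p t) - (f 0 - poly p 0)) \<le> (c * norm (t ^ n)) * norm (t - 0)"
    proof (rule field_differentiable_bound[of ?S "\<lambda>t. f t - poly p t" "\<lambda>t. f' t - poly (pderiv p) t"])
      fix x :: real assume x: "x \<in> ?S"
      then have xd: "dist x 0 < d" using t by auto
      then show "((\<lambda>t. f t - poly p t) has_field_derivative f' x - poly (pderiv p) x) (at x within ?S)"
        by (intro derivative_intros f' poly_DERIV has_field_derivative_at_within[of _ _ _ ?S])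
      have "norm (x ^ n) \<le> norm (t ^ n)"
        using x by (auto simp: power_abs intro!: power_mono)
      then show "norm (f' x - poly (pderiv p) x) \<le> c * norm (t ^ n)"
        using b[OF xd] \<open>c > 0\<close> by (meson mult_left_mono order_trans less_imp_le)
    qed auto
    then show ?thesis using assms(3) by (simp add: abs_mult mult_ac)
  qed
  then show "eventually (\<lambda>t. norm (f t - poly p t) \<le> c * norm (t ^ Suc n)) (nhds 0)"
    unfolding eventually_nhds_metric using d by blast
qed

lemma norm_smallo_iff:
  fixes f :: "real \<Rightarrow> 'a::euclidean_space"
  shows "(\<lambda>t. norm (f t)) \<in> o[F](g) \<longleftrightarrow> (\<forall>b\<in>Basis. (\<lambda>t. f t \<bullet> b) \<in> o[F](g))"
proof (intro iffI ballI)
  fix b :: 'a assume n: "(\<lambda>t. norm (f t)) \<in> o[F](g)" and "b \<in> Basis"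
  then have "(\<lambda>t. f t \<bullet> b) \<in> O[F](\<lambda>t. norm (f t))"
    by (intro bigoI[of _ 1] always_eventually) (simp add: Basis_le_norm)
  then show "(\<lambda>t. f t \<bullet> b) \<in> o[F](g)" using n by (rule landau_o.big_small_trans)
next
  assume b: "\<forall>b\<in>Basis. (\<lambda>t. f t \<bullet> b) \<in> o[F](g)"
  have "(\<lambda>t. norm (f t)) \<in> O[F](\<lambda>t. \<Sum>b\<in>Basis. \<bar>f t \<bullet> b\<bar>)"
    by (intro bigoI[of _ 1] always_eventually) (use norm_le_l1 in \<open>auto intro: order_trans[OF norm_le_l1]\<close>)
  moreover have "(\<lambda>t. \<Sum>b\<in>Basis. \<bar>f t \<bullet> b\<bar>) \<in> o[F](g)"
    using b by (intro big_sum_in_smallo) auto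
  ultimately show "(\<lambda>t. norm (f t)) \<in> o[F](g)" by (rule landau_o.big_small_trans)
qed

section \<open>Taylor polynomials of smooth maps\<close>

text \<open>Needed because the derivative along the unit vector coincides with \<open>vector_derivative\<close>
  only where the function is differentiable, that is, on \<open>S\<close>.\<close>

lemma Ck_on_cong:
  fixes f g :: "'a::euclidean_space \<Rightarrow> 'b::euclidean_space"
  assumes "open S" "\<And>x. x \<in> S \<Longrightarrow> f x = g x" "Ck_on k S f"
  shows "Ck_on k S g"
  using assms(2,3)
proof (induction k arbitrary: f g)
  case 0
  then show ?case using continuous_on_cong[of S S f g] by simp
next
  case (Suc k)
  have d: "(g has_derivative f') (at x)" if "(f has_derivative f') (at x)" "x \<in> S" for f' x
    using has_derivative_transform_within_open[OF that(1) assms(1) that(2)] Suc.prems(1) by blast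
  have diff: "f differentiable at x" if "x \<in> S" for x using Suc.prems(2) that by simp
  have "frechet_derivative f (at x) = frechet_derivative g (at x)" if "x \<in> S" for x
    using frechet_derivative_at[OF d[OF _ that]] diff[OF that] frechet_derivative_works by blast
  moreover have "g differentiable at x" if "x \<in> S" for x
    using d[OF _ that] diff[OF that] unfolding differentiable_def by blast
  ultimately show ?case
    using Suc.IH[of "\<lambda>x. frechet_derivative f (at x) v" "\<lambda>x. frechet_derivative g (at x) v" for v]
      Suc.prems(2) by simp
qed

lemma Ck_on_Suc_vector_derivative:
  fixes f :: "real \<Rightarrow> 'b::euclidean_space"
  assumes "open S" "Ck_on (Suc k) S f"
  shows "Ck_on k S (\<lambda>x. vector_derivative f (at x))"
proof (rule Ck_on_cong[OF assms(1)])
  show "Ck_on k S (\<lambda>x. frechet_derivative f (at x) 1)" using assms(2) by simp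
  show "frechet_derivative f (at x) 1 = vector_derivative f (at x)" if "x \<in> S" for x
  proof -
    have "(f has_vector_derivative vector_derivative f (at x)) (at x)"
      using assms(2) that vector_derivative_works by auto
    from frechet_derivative_at[OF this[unfolded has_vector_derivative_def], symmetric]
    show ?thesis by simp
  qed
qed

text \<open>The iteration defining \<open>curve_deriv\<close>, at a type that also covers real-valued parameter
  changes.\<close>

definition iter_deriv :: "nat \<Rightarrow> (real \<Rightarrow> 'b::euclidean_space) \<Rightarrow> real \<Rightarrow> 'b" where
  "iter_deriv n f = ((\<lambda>f t. vector_derivative f (at t)) ^^ n) f"

lemma iter_deriv_0: "iter_deriv 0 f = f"
  by (simp add: iter_deriv_def)

lemma iter_deriv_Suc: "iter_deriv (Suc n) f = iter_deriv n (\<lambda>t. vector_derivative f (at t))"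
  by (simp add: iter_deriv_def funpow_Suc_right del: funpow.simps)

text \<open>The Taylor polynomial of the scalar function \<open>f \<bullet> b\<close>: jets of vector-valued maps are handled
  one direction \<open>b\<close> at a time.\<close>

definition taylor_poly :: "nat \<Rightarrow> (real \<Rightarrow> 'b::euclidean_space) \<Rightarrow> 'b \<Rightarrow> real poly" where
  "taylor_poly n f b = (\<Sum>k\<le>n. monom ((iter_deriv k f 0 \<bullet> b) / fact k) k)"

lemma coeff_taylor_poly:
  "coeff (taylor_poly n f b) k = (if k \<le> n then (iter_deriv k f 0 \<bullet> b) / fact k else 0)"
  by (simp add: taylor_poly_def coeff_sum)

lemma pderiv_taylor_poly:
  "pderiv (taylor_poly (Suc n) f b) = taylor_poly n (\<lambda>t. vector_derivative f (at t)) b"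
proof (rule poly_eqI)
  fix k
  have "of_nat (Suc k) * (x / fact (Suc k)) = x / fact k" for x :: real
    by (simp only: fact_Suc of_nat_mult nonzero_mult_divide_mult_cancel_left flip: times_divide_eq_right)
      (simp del: of_nat_Suc)
  then show "coeff (pderiv (taylor_poly (Suc n) f b)) k
      = coeff (taylor_poly n (\<lambda>t. vector_derivative f (at t)) b) k"
    by (simp add: coeff_pderiv coeff_taylor_poly iter_deriv_Suc del: of_nat_Suc fact_Suc)
qed

text \<open>Taylor's formula with Peano remainder, obtained by integrating the formula for the derivative.\<close>

lemma jet_taylor_poly:
  fixes f :: "real \<Rightarrow> 'b::euclidean_space"
  assumes "open S" "0 \<in> S" "Ck_on n S f"
  shows "jet n (\<lambda>t. f t \<bullet> b) (taylor_poly n f b)"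
  using assms(3)
proof (induction n arbitrary: f)
  case 0
  then have "isCont f 0" using assms by (simp add: continuous_on_eq_continuous_at)
  then have "((\<lambda>t. f t) \<longlongrightarrow> f 0) (nhds 0)"
    by (simp add: continuous_at tendsto_at_iff_tendsto_nhds)
  then have "((\<lambda>t. (f t \<bullet> b - f 0 \<bullet> b) / t ^ 0) \<longlongrightarrow> 0) (nhds 0)"
    by (auto intro!: tendsto_eq_intros)
  then have "(\<lambda>t. f t \<bullet> b - f 0 \<bullet> b) \<in> o[nhds 0](\<lambda>t. t ^ 0)"
    by (rule smalloI_tendsto) auto
  then show ?case by (simp add: jet_def taylor_poly_def iter_deriv_0 poly_monom)
next
  case (Suc n)
  let ?f' = "\<lambda>t. vector_derivative f (at t)"
  show ?case
  proof (rule jet_integrate[where f' = "\<lambda>t. ?f' t \<bullet> b"])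
    have "((\<lambda>t. f t \<bullet> b) has_real_derivative ?f' x \<bullet> b) (at x)" if "x \<in> S" for x
    proof -
      have "(f has_vector_derivative ?f' x) (at x)"
        using Suc.prems that vector_derivative_works by auto
      from bounded_linear.has_vector_derivative[OF bounded_linear_inner_left this]
      show ?thesis by (simp add: has_real_derivative_iff_has_vector_derivative)
    qed
    then show "eventually (\<lambda>t. ((\<lambda>t. f t \<bullet> b) has_real_derivative ?f' t \<bullet> b) (at t)) (nhds 0)"
      using assms(1,2) eventually_nhds by blast
    show "jet n (\<lambda>t. ?f' t \<bullet> b) (pderiv (taylor_poly (Suc n) f b))"
      unfolding pderiv_taylor_poly
      by (rule Suc.IH) (rule Ck_on_Suc_vector_derivative[OF assms(1) Suc.prems])
    show "f 0 \<bullet> b = poly (taylor_poly (Suc n) f b) 0"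
      by (simp add: poly_0_coeff_0 coeff_taylor_poly iter_deriv_0)
  qed
qed

lemma Ck_on_poly: "Ck_on k S (poly (p :: real poly))"
proof (induction k arbitrary: p)
  case 0 show ?case by (auto intro!: continuous_intros)
next
  case (Suc k)
  have "(poly p has_derivative (\<lambda>v. poly (pderiv p) x * v)) (at x)" for x
    using poly_DERIV[of p x] by (simp add: has_field_derivative_def)
  then have d: "poly p differentiable (at x)"
    "frechet_derivative (poly p) (at x) = (\<lambda>v. poly (pderiv p) x * v)" for x
    by (auto simp: differentiable_def frechet_derivative_at[symmetric])
  have "(\<lambda>x. frechet_derivative (poly p) (at x) v) = poly (smult v (pderiv p))" for v
    by (auto simp: d)
  then show ?case using Suc.IH d(1) by simp
qed

lemma curve_deriv_iter: "curve_deriv n \<gamma> = iter_deriv n \<gamma>"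
  by (simp add: curve_deriv_def iter_deriv_def)

section \<open>Coefficients of a composition\<close>

lemma coeff_mult_0_left:
  fixes q r :: "real poly"
  assumes "coeff q 0 = 0"
  shows "coeff (q * r) 0 = 0"
    "coeff (q * r) 1 = coeff q 1 * coeff r 0"
    "coeff (q * r) 2 = coeff q 1 * coeff r 1 + coeff q 2 * coeff r 0"
    "coeff (q * r) 3 = coeff q 1 * coeff r 2 + coeff q 2 * coeff r 1 + coeff q 3 * coeff r 0"
    "coeff (q * r) 4 = coeff q 1 * coeff r 3 + coeff q 2 * coeff r 2 + coeff q 3 * coeff r 1
       + coeff q 4 * coeff r 0"
    "coeff (q * r) 5 = coeff q 1 * coeff r 4 + coeff q 2 * coeff r 3 + coeff q 3 * coeff r 2
       + coeff q 4 * coeff r 1 + coeff q 5 * coeff r 0"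
  using assms by (simp_all add: coeff_mult eval_nat_numeral)

text \<open>The formula of Faa di Bruno up to order five, found by Horner's scheme: each factor \<open>q\<close>
  without constant term shifts the coefficients that still matter.\<close>

lemma coeff_pcompose_0_left:
  fixes p q :: "real poly"
  assumes q: "coeff q 0 = 0"
  defines "a \<equiv> coeff p" and "u \<equiv> coeff q"
  shows "coeff (pcompose p q) 1 = a 1 * u 1"
    "coeff (pcompose p q) 2 = a 1 * u 2 + a 2 * u 1 ^ 2"
    "coeff (pcompose p q) 3 = a 1 * u 3 + 2 * a 2 * u 1 * u 2 + a 3 * u 1 ^ 3"
    "coeff (pcompose p q) 4 = a 1 * u 4 + a 2 * (u 2 ^ 2 + 2 * u 1 * u 3) + 3 * a 3 * u 1 ^ 2 * u 2
       + a 4 * u 1 ^ 4"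
    "coeff (pcompose p q) 5 = a 1 * u 5 + a 2 * (2 * u 1 * u 4 + 2 * u 2 * u 3)
       + a 3 * (3 * u 1 ^ 2 * u 3 + 3 * u 1 * u 2 ^ 2) + 4 * a 4 * u 1 ^ 3 * u 2 + a 5 * u 1 ^ 5"
proof -
  obtain a0 a1 a2 a3 a4 a5 r where
    p: "p = pCons a0 (pCons a1 (pCons a2 (pCons a3 (pCons a4 (pCons a5 r)))))"
    by (metis pCons_cases)
  have a: "a 1 = a1" "a 2 = a2" "a 3 = a3" "a 4 = a4" "a 5 = a5"
    by (simp_all add: a_def p eval_nat_numeral)
  have c: "coeff [:x:] 1 = 0" "coeff [:x:] 2 = 0" "coeff [:x:] 3 = 0" "coeff [:x:] 4 = 0" "coeff [:x:] 5 = 0" for x :: real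
    by (simp_all add: eval_nat_numeral)
  note simps = pcompose_pCons coeff_mult_0_left[OF q] c
  show "coeff (pcompose p q) 1 = a 1 * u 1"
    "coeff (pcompose p q) 2 = a 1 * u 2 + a 2 * u 1 ^ 2"
    "coeff (pcompose p q) 3 = a 1 * u 3 + 2 * a 2 * u 1 * u 2 + a 3 * u 1 ^ 3"
    "coeff (pcompose p q) 4 = a 1 * u 4 + a 2 * (u 2 ^ 2 + 2 * u 1 * u 3) + 3 * a 3 * u 1 ^ 2 * u 2
       + a 4 * u 1 ^ 4"
    "coeff (pcompose p q) 5 = a 1 * u 5 + a 2 * (2 * u 1 * u 4 + 2 * u 2 * u 3)
       + a 3 * (3 * u 1 ^ 2 * u 3 + 3 * u 1 * u 2 ^ 2) + 4 * a 4 * u 1 ^ 3 * u 2 + a 5 * u 1 ^ 5"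
    unfolding a u_def
    by (simp_all add: p simps del: One_nat_def) algebra+
qed

section \<open>The curvature on the level of derivative vectors\<close>

text \<open>The derivatives of orders two to five at \<open>0\<close> of \<open>\<gamma> \<circ> u\<close>, where \<open>d k\<close> is the \<open>k\<close>-th derivative
  of \<open>\<gamma>\<close> at \<open>0\<close> with \<open>d 1 = 0\<close>, and \<open>u k\<close> is the \<open>k\<close>-th Taylor coefficient (not the
  derivative) of \<open>u\<close>. The last branch is meant for \<open>k = 5\<close>.\<close>

definition reparam_jet :: "(nat \<Rightarrow> real) \<Rightarrow> (nat \<Rightarrow> 'v::real_vector) \<Rightarrow> nat \<Rightarrow> 'v" where
  "reparam_jet u d k =
     (if k = 2 then u 1 ^ 2 *\<^sub>R d 2
      else if k = 3 then u 1 ^ 3 *\<^sub>R d 3 + (6 * u 1 * u 2) *\<^sub>R d 2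
      else if k = 4 then u 1 ^ 4 *\<^sub>R d 4 + (12 * u 1 ^ 2 * u 2) *\<^sub>R d 3
        + (12 * (u 2 ^ 2 + 2 * u 1 * u 3)) *\<^sub>R d 2
      else u 1 ^ 5 *\<^sub>R d 5 + (20 * u 1 ^ 3 * u 2) *\<^sub>R d 4
        + (60 * (u 1 ^ 2 * u 3 + u 1 * u 2 ^ 2)) *\<^sub>R d 3
        + (120 * (u 1 * u 4 + u 2 * u 3)) *\<^sub>R d 2)"

lemma reparam_jet_simps:
  "reparam_jet u d 2 = u 1 ^ 2 *\<^sub>R d 2"
  "reparam_jet u d 3 = u 1 ^ 3 *\<^sub>R d 3 + (6 * u 1 * u 2) *\<^sub>R d 2"
  "reparam_jet u d 4 = u 1 ^ 4 *\<^sub>R d 4 + (12 * u 1 ^ 2 * u 2) *\<^sub>R d 3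
     + (12 * (u 2 ^ 2 + 2 * u 1 * u 3)) *\<^sub>R d 2"
  "reparam_jet u d 5 = u 1 ^ 5 *\<^sub>R d 5 + (20 * u 1 ^ 3 * u 2) *\<^sub>R d 4
     + (60 * (u 1 ^ 2 * u 3 + u 1 * u 2 ^ 2)) *\<^sub>R d 3
     + (120 * (u 1 * u 4 + u 2 * u 3)) *\<^sub>R d 2"
  by (simp_all add: reparam_jet_def)

lemma bracket_bilinear:
  "bracket (a + b) c = bracket a c + bracket b c"
  "bracket a (b + c) = bracket a b + bracket a c"
  "bracket (r *\<^sub>R a) b = r * bracket a b"
  "bracket a (r *\<^sub>R b) = r * bracket a b"
  by (simp_all add: bracket_def algebra_simps)

lemma bracket_self: "bracket a a = 0"
  by (simp add: bracket_def)

lemma bracket_commute: "bracket a b = - bracket b a"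
  by (simp add: bracket_def)

lemma bracket_matrix_vector_mult: "bracket (A *v a) (A *v b) = det A * bracket a b"
  by (simp add: bracket_def det_2 matrix_vector_mult_def sum_2 algebra_simps)

lemma cramer_bracket: "bracket a b *\<^sub>R v = bracket v b *\<^sub>R a + bracket a v *\<^sub>R b"
  by (simp add: vec_eq_iff forall_2 bracket_def algebra_simps)

definition cusp_numerator :: "(nat \<Rightarrow> real^2) \<Rightarrow> real" where
  "cusp_numerator d = 24 * bracket (d 2) (d 3) * bracket (d 2) (d 5)
       + 60 * bracket (d 2) (d 3) * bracket (d 3) (d 4) - 35 * (bracket (d 2) (d 4)) ^ 2"

lemma reparam_bracket_23: "bracket (reparam_jet u d 2) (reparam_jet u d 3) = u 1 ^ 5 * bracket (d 2) (d 3)"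
  by (simp add: reparam_jet_simps bracket_bilinear bracket_self)

text \<open>The identity that makes the curvature an invariant. The coefficients 24, 60 and 35 are, up
  to a common factor, those for which the contributions of \<open>u 2\<close> and \<open>u 3\<close> cancel; \<open>u 4\<close> enters only through a
  multiple of \<open>d 2\<close> in the fifth derivative, which the bracket with \<open>d 2\<close> kills.\<close>

lemma cusp_numerator_reparam: "cusp_numerator (reparam_jet u d) = u 1 ^ 12 * cusp_numerator d"
proof -
  have s: "bracket (d 3) (d 2) = - bracket (d 2) (d 3)" "bracket (d 4) (d 2) = - bracket (d 2) (d 4)"
      "bracket (d 4) (d 3) = - bracket (d 3) (d 4)"
    by (rule bracket_commute)+
  show ?thesis
    unfolding cusp_numerator_def reparam_jet_simps
    by (simp only: bracket_bilinear bracket_self s) algebra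
qed

lemma cusp_numerator_matrix:
  assumes "\<bar>det (A::real^2^2)\<bar> = 1"
  shows "cusp_numerator (\<lambda>k. A *v d k) = cusp_numerator d"
proof -
  have "det A * det A = 1" using assms by (metis abs_mult_self_eq mult_1)
  then show ?thesis unfolding cusp_numerator_def bracket_matrix_vector_mult by algebra
qed

lemma powr_12_5:
  assumes "(u::real) > 0" shows "(u ^ 5) powr (12 / 5) = u ^ 12"
proof -
  have "(u powr 5) powr (12 / 5) = u powr 12" unfolding powr_powr by simp
  then show ?thesis using assms by simp
qed

lemma curvature_reparam:
  assumes "\<bar>det (A::real^2^2)\<bar> = 1" "u 1 > 0"
    and D: "\<And>k. k \<in> {2..5} \<Longrightarrow> D k = A *v reparam_jet u d k"
  shows "cusp_numerator D / \<bar>bracket (D 2) (D 3)\<bar> powr (12/5)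
    = cusp_numerator d / \<bar>bracket (d 2) (d 3)\<bar> powr (12/5)"
proof -
  have "cusp_numerator D = cusp_numerator (\<lambda>k. A *v reparam_jet u d k)"
    unfolding cusp_numerator_def by (simp add: D)
  also have "\<dots> = u 1 ^ 12 * cusp_numerator d"
    by (simp add: cusp_numerator_matrix[OF assms(1)] cusp_numerator_reparam)
  finally have 1: "cusp_numerator D = u 1 ^ 12 * cusp_numerator d" .
  have "\<bar>bracket (D 2) (D 3)\<bar> = u 1 ^ 5 * \<bar>bracket (d 2) (d 3)\<bar>"
    using assms(1,2) by (simp add: D bracket_matrix_vector_mult reparam_bracket_23 abs_mult)
  then have "\<bar>bracket (D 2) (D 3)\<bar> powr (12/5) = u 1 ^ 12 * \<bar>bracket (d 2) (d 3)\<bar> powr (12/5)"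
    using assms(2) by (simp add: powr_mult powr_12_5)
  then show ?thesis using 1 assms(2) by simp
qed

lemma matrix_of_frames:
  assumes "bracket a b \<noteq> 0"
  obtains A :: "real^2^2" where "A *v a = c" "A *v b = d" "det A = bracket c d / bracket a b"
proof -
  \<comment> \<open>The matrix with columns \<open>c, d\<close> times the inverse of the one with columns \<open>a, b\<close>.\<close>
  define A :: "real^2^2" where "A = (\<chi> i j. (c $ i * (if j = 1 then b $ 2 else - b $ 1)
      + d $ i * (if j = 1 then - a $ 2 else a $ 1)) / bracket a b)"
  have A: "A *v v = (bracket v b / bracket a b) *\<^sub>R c + (bracket a v / bracket a b) *\<^sub>R d" for v
    by (simp add: A_def vec_eq_iff forall_2 matrix_vector_mult_def sum_2 bracket_def[of v b] bracket_def[of a v]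
        add_divide_distrib diff_divide_distrib algebra_simps)
  have 1: "A *v a = c" and 2: "A *v b = d"
    using assms by (simp_all add: A bracket_self)
  have "det A = bracket c d / bracket a b"
    using bracket_matrix_vector_mult[of A a b] assms by (simp add: 1 2)
  with 1 2 that show thesis by blast
qed

text \<open>By Cramer's rule a vector is determined by its brackets with a basis; so whether \<open>A\<close> maps \<open>v\<close>
  to \<open>w\<close> can be tested on brackets.\<close>

lemma matrix_maps_via_brackets:
  assumes ab: "bracket a b \<noteq> 0" and det: "det A \<noteq> 0"
    and "bracket (A *v b) w = det A * bracket b v" "bracket (A *v a) w = det A * bracket a v"
  shows "A *v v = w"
proof -
  have "bracket (A *v a) (A *v b) *\<^sub>R (A *v v) = bracket (A *v a) (A *v b) *\<^sub>R w"
    unfolding cramer_bracket[of "A *v a" "A *v b" "A *v v"] cramer_bracket[of "A *v a" "A *v b" w]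
    using assms bracket_matrix_vector_mult bracket_commute by metis
  then show ?thesis using ab det by (simp add: bracket_matrix_vector_mult)
qed

text \<open>The parameter change is found coefficient by coefficient. First \<open>u 1\<close> makes the ratio \<open>\<rho>\<close> of
  \<open>[D 2, D 3]\<close> to \<open>[e 2, e 3]\<close> equal to \<open>\<plusminus>1\<close>, where \<open>e\<close> is the reparametrized sequence. Then
  \<open>[e 2, e 4]\<close> is affine in \<open>u 2\<close>, \<open>[e 3, e 4]\<close> in \<open>u 3\<close> and \<open>[e 3, e 5]\<close> in \<open>u 4\<close>, and
  each can be given the value required by \<open>D\<close>. The last bracket \<open>[e 2, e 5]\<close> cannot be adjusted
  any more, but it is recovered from the numerator of the curvature.\<close>

lemma reparam_exists:
  assumes d: "bracket (d 2) (d 3) \<noteq> 0" and D: "bracket (D 2) (D 3) \<noteq> 0"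
    and eq: "cusp_numerator D / \<bar>bracket (D 2) (D 3)\<bar> powr (12/5)
    = cusp_numerator d / \<bar>bracket (d 2) (d 3)\<bar> powr (12/5)"
  obtains A :: "real^2^2" and u where "\<bar>det A\<bar> = 1" "u 1 > 0"
    "\<And>k. k \<in> {2..5} \<Longrightarrow> D k = A *v reparam_jet u d k"
proof -
  let ?\<delta> = "bracket (d 2) (d 3)" and ?\<Delta> = "bracket (D 2) (D 3)"
  \<comment> \<open>The coefficient \<open>u 1\<close>: the only positive factor whose fifth power is the ratio of the brackets.\<close>
  define \<sigma> where "\<sigma> = (\<bar>?\<Delta>\<bar> / \<bar>?\<delta>\<bar>) powr (1 / 5)"
  have lpos: "\<sigma> > 0" using d D by (simp add: \<sigma>_def)
  have "\<sigma> ^ 5 = \<bar>?\<Delta>\<bar> / \<bar>?\<delta>\<bar>"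
  proof -
    have "\<sigma> powr 5 = \<bar>?\<Delta>\<bar> / \<bar>?\<delta>\<bar>" unfolding \<sigma>_def powr_powr using d D by simp
    then show ?thesis using lpos by simp
  qed
  then have l5: "\<bar>?\<Delta>\<bar> = \<sigma> ^ 5 * \<bar>?\<delta>\<bar>" using d by (simp add: field_simps)
  then have "\<bar>?\<Delta>\<bar> powr (12/5) = \<sigma> ^ 12 * \<bar>?\<delta>\<bar> powr (12/5)"
    using lpos by (simp add: powr_mult powr_12_5)
  then have num: "cusp_numerator D = \<sigma> ^ 12 * cusp_numerator d"
    using eq lpos d by (simp add: field_simps)
  define \<rho> where "\<rho> = ?\<Delta> / (\<sigma> ^ 5 * ?\<delta>)"
  have r1: "\<bar>\<rho>\<bar> = 1" using l5 lpos d D by (simp add: \<rho>_def abs_mult)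
  then have rr: "\<rho> * \<rho> = 1" by (metis abs_mult_self_eq mult_1)
  define u2 where "u2 = (bracket (D 2) (D 4) / \<rho> - \<sigma> ^ 6 * bracket (d 2) (d 4)) / (12 * \<sigma> ^ 4 * ?\<delta>)"
  \<comment> \<open>The sequences \<open>v\<close> and \<open>w\<close> hold the coefficients found so far and \<open>0\<close> in
    place of the next one, which enters the bracket to be adjusted as an added multiple.\<close>
  define v where "v = (\<lambda>k::nat. if k = 1 then \<sigma> else if k = 2 then u2 else 0)"
  define u3 where "u3 = (bracket (reparam_jet v d 3) (reparam_jet v d 4) - bracket (D 3) (D 4) / \<rho>)
    / (24 * \<sigma> ^ 4 * ?\<delta>)"
  define w where "w = v(3 := u3)"
  define u4 where "u4 = (bracket (reparam_jet w d 3) (reparam_jet w d 5) - bracket (D 3) (D 5) / \<rho>)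
    / (120 * \<sigma> ^ 4 * ?\<delta>)"
  define u where "u = w(4 := u4)"
  have u: "u 1 = \<sigma>" "u 2 = u2" "u 3 = u3" "u 4 = u4"
    by (simp_all add: u_def w_def v_def)
  have v: "v 1 = \<sigma>" "v 2 = u2" "v 3 = 0" "v 4 = 0"
    and w: "w 1 = \<sigma>" "w 2 = u2" "w 3 = u3" "w 4 = 0"
    by (simp_all add: w_def v_def)
  define e where "e = reparam_jet u d"
  have e23: "bracket (e 2) (e 3) = \<sigma> ^ 5 * ?\<delta>" by (simp add: e_def reparam_bracket_23 u del: One_nat_def)
  have s: "bracket (d 3) (d 2) = - ?\<delta>" by (rule bracket_commute)
  have b24: "bracket (D 2) (D 4) = \<rho> * bracket (e 2) (e 4)"
  proof -
    have "bracket (e 2) (e 4) = \<sigma> ^ 6 * bracket (d 2) (d 4) + u2 * (12 * \<sigma> ^ 4 * ?\<delta>)"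
      unfolding e_def reparam_jet_simps u bracket_bilinear bracket_self by algebra
    also have "\<dots> = bracket (D 2) (D 4) / \<rho>"
      using d lpos by (simp add: u2_def)
    finally show ?thesis using r1 by auto
  qed
  have b34: "bracket (D 3) (D 4) = \<rho> * bracket (e 3) (e 4)"
  proof -
    have "bracket (e 3) (e 4) = bracket (reparam_jet v d 3) (reparam_jet v d 4) - u3 * (24 * \<sigma> ^ 4 * ?\<delta>)"
      unfolding e_def reparam_jet_simps u v bracket_bilinear bracket_self s by algebra
    also have "\<dots> = bracket (D 3) (D 4) / \<rho>"
      using d lpos by (simp add: u3_def)
    finally show ?thesis using r1 by auto
  qed
  have b35: "bracket (D 3) (D 5) = \<rho> * bracket (e 3) (e 5)"
  proof -
    have "bracket (e 3) (e 5) = bracket (reparam_jet w d 3) (reparam_jet w d 5) - u4 * (120 * \<sigma> ^ 4 * ?\<delta>)"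
      unfolding e_def reparam_jet_simps u w bracket_bilinear bracket_self s by algebra
    also have "\<dots> = bracket (D 3) (D 5) / \<rho>"
      using d lpos by (simp add: u4_def)
    finally show ?thesis using r1 by auto
  qed
  have b23: "?\<Delta> = \<rho> * bracket (e 2) (e 3)"
    using d lpos by (simp add: e23 \<rho>_def)
  \<comment> \<open>Equal curvatures supply the one bracket that is left.\<close>
  have "cusp_numerator D = cusp_numerator e"
    by (simp add: num e_def cusp_numerator_reparam u del: One_nat_def)
  then have "24 * (bracket (e 2) (e 3) * \<rho>) * bracket (D 2) (D 5)
      = 24 * (bracket (e 2) (e 3) * \<rho>) * (\<rho> * bracket (e 2) (e 5))"
    unfolding cusp_numerator_def b23 b34 b24 using rr by algebra
  then have b25: "bracket (D 2) (D 5) = \<rho> * bracket (e 2) (e 5)"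
    using D b23 by simp
  have ene: "bracket (e 2) (e 3) \<noteq> 0" using b23 D by auto
  obtain A :: "real^2^2" where A: "A *v e 2 = D 2" "A *v e 3 = D 3"
    "det A = ?\<Delta> / bracket (e 2) (e 3)"
    using matrix_of_frames[OF ene] .
  have det: "det A = \<rho>" using A(3) ene b23 by simp
  have A4: "A *v e 4 = D 4" and A5: "A *v e 5 = D 5"
    by (rule matrix_maps_via_brackets[OF ene]; use r1 in \<open>auto simp: A(1,2) det b24 b34 b25 b35\<close>)+
  show thesis
  proof
    show "\<bar>det A\<bar> = 1" "u 1 > 0" using det r1 lpos u by auto
    fix k :: nat assume "k \<in> {2..5}"
    then consider "k = 2" | "k = 3" | "k = 4" | "k = 5" by force
    then show "D k = A *v reparam_jet u d k"
      using A A4 A5 by cases (simp_all add: e_def)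
  qed
qed

section \<open>Derivatives at a cusp\<close>

text \<open>Along the cusp the velocity \<open>2t v + 3t\<^sup>2 w\<close> vanishes at \<open>0\<close>, so the derivative of \<open>\<Psi>\<close> in the
  direction \<open>v\<close> is constant up to \<open>o(t)\<close>, and the one in the direction \<open>w\<close> up to \<open>o(1)\<close>. The
  derivative of the curve is therefore known up to \<open>o(t\<^sup>2)\<close>, and integrating gives its 3-jet
  without any Taylor formula in several variables.\<close>

lemma jet_along_cusp:
  fixes \<Psi> :: "'a::euclidean_space \<Rightarrow> 'b::euclidean_space"
  assumes "open V" "0 \<in> V" "Ck_on 2 V \<Psi>"
  defines "D \<equiv> frechet_derivative \<Psi> (at 0)"
  shows "jet 3 (\<lambda>t. \<Psi> (t ^ 2 *\<^sub>R v + t ^ 3 *\<^sub>R w) \<bullet> b) [:\<Psi> 0 \<bullet> b, 0, D v \<bullet> b, D w \<bullet> b:]"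
proof -
  define x where "x t = t ^ 2 *\<^sub>R v + t ^ 3 *\<^sub>R w" for t :: real
  define h where "h y t = frechet_derivative \<Psi> (at (x t)) y \<bullet> b" for y t
  have x0: "x 0 = 0" by (simp add: x_def)
  have x': "(x has_vector_derivative (2 * t) *\<^sub>R v + (3 * t ^ 2) *\<^sub>R w) (at t)" for t
    unfolding x_def by (auto intro!: derivative_eq_intros)
  have C1: "\<Psi> differentiable at y" "continuous_on V (\<lambda>y. frechet_derivative \<Psi> (at y) z)"
      "(\<lambda>y. frechet_derivative \<Psi> (at y) z) differentiable at y" if "y \<in> V" for y z
    using assms(3) that
    by (auto simp: numeral_2_eq_2 intro!: differentiable_imp_continuous_on differentiable_at_imp_differentiable_on)
  have contx: "isCont x t" for t
    using x' by (rule has_vector_derivative_continuous)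
  have h': "(h z has_real_derivative 0) (at 0)" for z
  proof -
    obtain L where L: "((\<lambda>y. frechet_derivative \<Psi> (at y) z) has_derivative L) (at (x 0))"
      using C1(3)[OF assms(2)] x0 by (auto simp: differentiable_def)
    have "(x has_derivative (\<lambda>_. 0)) (at 0)"
      using x'[of 0] by (simp add: has_vector_derivative_def)
    from has_derivative_compose[OF this L]
    have "((\<lambda>t. frechet_derivative \<Psi> (at (x t)) z) has_derivative (\<lambda>_. 0)) (at 0)"
      using linear_0[OF has_derivative_linear[OF L]] by simp
    from has_derivative_inner_left[OF this, of b]
    show ?thesis by (simp add: h_def[abs_def] has_field_derivative_def flip: lambda_zero)
  qed
  have h0: "h z 0 = D z \<bullet> b" for z by (simp add: h_def x0 D_def)
  have "(\<lambda>t. t * (h v t - D v \<bullet> b)) \<in> o[nhds 0](\<lambda>t. t * t ^ 1)"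
    using jet_1_deriv[OF h'[of v]] by (intro landau_o.big_small_mult) (auto simp: jet_def h0)
  then have 1: "(\<lambda>t. 2 * (t * (h v t - D v \<bullet> b))) \<in> o[nhds 0](\<lambda>t. t ^ 2)"
    by (simp add: power2_eq_square)
  have "(\<lambda>t. t ^ 2 * (h w t - D w \<bullet> b)) \<in> o[nhds 0](\<lambda>t. t ^ 2 * t ^ 0)"
    using jet_0_isCont[OF DERIV_isCont[OF h'[of w]]]
    by (intro landau_o.big_small_mult) (auto simp: jet_def h0)
  then have 2: "(\<lambda>t. 3 * (t ^ 2 * (h w t - D w \<bullet> b))) \<in> o[nhds 0](\<lambda>t. t ^ 2)"
    by simp
  have "jet (Suc 2) (\<lambda>t. \<Psi> (x t) \<bullet> b) [:\<Psi> 0 \<bullet> b, 0, D v \<bullet> b, D w \<bullet> b:]"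
  proof (rule jet_integrate[where f' = "\<lambda>t. 2 * t * h v t + 3 * t ^ 2 * h w t"])
    have "open (x -` V)"
      using contx assms(1) by (intro continuous_open_vimage) (auto simp: continuous_at_imp_continuous_on)
    then have "eventually (\<lambda>t. t \<in> x -` V) (nhds 0)"
      using assms(2) x0 by (intro eventually_nhds_in_open) auto
    then show "\<forall>\<^sub>F t in nhds 0. ((\<lambda>t. \<Psi> (x t) \<bullet> b) has_real_derivative 2 * t * h v t + 3 * t\<^sup>2 * h w t) (at t)"
    proof eventually_elim
      case (elim t)
      let ?D = "frechet_derivative \<Psi> (at (x t))"
      have D: "(\<Psi> has_derivative ?D) (at (x t))"
        using C1(1) elim frechet_derivative_works by blast
      interpret D: linear ?D by (rule has_derivative_linear[OF D])
      have "((\<lambda>t. \<Psi> (x t)) has_derivative (\<lambda>s. ?D (s *\<^sub>R ((2 * t) *\<^sub>R v + (3 * t ^ 2) *\<^sub>R w)))) (at t)"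
        using has_derivative_compose[OF x'[of t, unfolded has_vector_derivative_def] D] .
      from has_derivative_inner_left[OF this, of b] show ?case
        unfolding has_field_derivative_def
        by (rule has_derivative_eq_rhs)
          (simp add: fun_eq_iff h_def D.scale D.add inner_add_left algebra_simps)
    qed
    have "(\<lambda>t. 2 * (t * (h v t - D v \<bullet> b)) + 3 * (t ^ 2 * (h w t - D w \<bullet> b))) \<in> o[nhds 0](\<lambda>t. t ^ 2)"
      by (rule sum_in_smallo(1)[OF 1 2])
    also have "(\<lambda>t. 2 * (t * (h v t - D v \<bullet> b)) + 3 * (t ^ 2 * (h w t - D w \<bullet> b)))
       = (\<lambda>t. (2 * t * h v t + 3 * t ^ 2 * h w t)
           - poly (pderiv [:\<Psi> 0 \<bullet> b, 0, D v \<bullet> b, D w \<bullet> b:]) t)"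
      by (simp add: pderiv_pCons fun_eq_iff algebra_simps power2_eq_square)
    finally show "jet 2 (\<lambda>t. 2 * t * h v t + 3 * t\<^sup>2 * h w t)
        (pderiv [:\<Psi> 0 \<bullet> b, 0, D v \<bullet> b, D w \<bullet> b:])"
      unfolding jet_def .
  qed (simp add: x0)
  then show ?thesis by (simp add: x_def)
qed

lemma bracket_nonzero_if_linear_image:
  assumes "linear L" "L a = axis 1 1" "L b = (axis 2 1 :: real^2)"
  shows "bracket a b \<noteq> 0"
proof
  interpret L: linear L by fact
  assume "bracket a b = 0"
  then have 0: "a $ 1 * b $ 2 = a $ 2 * b $ 1" by (simp add: bracket_def)
  have "L (c *\<^sub>R a - d *\<^sub>R b) = vector [c, - d]" for c d
    by (simp add: L.diff L.scale assms(2,3) vec_eq_iff forall_2 axis_def)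
  moreover have "b $ i *\<^sub>R a - a $ i *\<^sub>R b = 0" for i
    using 0 exhaust_2[of i] by (auto simp: vec_eq_iff forall_2 mult_ac)
  ultimately have "vector [b $ i, - (a $ i)] = (0 :: real^2)" for i
    by (metis L.zero)
  then have "a = 0" by (metis vec_eq_iff vector_2(2) zero_index neg_equal_0_iff_equal)
  then have "L a = 0" by simp
  with assms(2) show False by (simp add: axis_eq_0_iff)
qed

text \<open>Compare the 3-jets of \<open>\<gamma> \<circ> s\<close> and of its expression \<open>\<Psi>(t\<^sup>2, t\<^sup>3)\<close>, with \<open>\<Psi>\<close> the inverse of the
  coordinate change \<open>\<Phi>\<close>. The second has no linear term, and its quadratic and cubic terms are
  linearly independent because the derivative of \<open>\<Psi>\<close> is injective. If \<open>s\<close> had derivative \<open>0\<close>,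
  then both of those terms would be multiples of the velocity of \<open>\<gamma>\<close>; so it has not, and the
  claims follow.\<close>

lemma cusp_derivatives:
  assumes "open I" "0 \<in> I" "smooth_on I \<gamma>" "has_cusp_3_2_at_0 \<gamma>"
  shows "curve_deriv 1 \<gamma> 0 = 0" "bracket (curve_deriv 2 \<gamma> 0) (curve_deriv 3 \<gamma> 0) \<noteq> 0"
proof -
  obtain J K s U V \<Phi> where s: "smooth_diffeo J K s" "0 \<in> J" "s 0 = (0::real)"
    and \<Phi>: "smooth_diffeo U V \<Phi>" and \<gamma>0: "\<gamma> 0 \<in> U"
    and eq: "\<And>t. t \<in> J \<Longrightarrow> \<gamma> (s t) \<in> U \<and> \<Phi> (\<gamma> (s t)) = vector [t ^ 2, t ^ 3]"
    using assms(4) unfolding has_cusp_3_2_at_0_def by blast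
  obtain \<Psi> where \<Psi>: "homeomorphism U V \<Phi> \<Psi>" "smooth_on V \<Psi>"
    and UV: "open U" "open V" and \<Phi>s: "smooth_on U \<Phi>"
    using \<Phi> unfolding smooth_diffeo_def by blast
  have J: "open J" and sm: "smooth_on J s" using s(1) unfolding smooth_diffeo_def by blast+
  let ?e = "axis 1 1 :: real^2" and ?f = "axis 2 1 :: real^2"
  define x where "x t = t ^ 2 *\<^sub>R ?e + t ^ 3 *\<^sub>R ?f" for t
  have x: "vector [t ^ 2, t ^ 3] = x t" for t
    by (simp add: x_def vec_eq_iff forall_2 axis_def)
  have gs: "\<gamma> (s t) = \<Psi> (x t)" if "t \<in> J" for t
    using eq[OF that] \<Psi>(1) unfolding x by (metis homeomorphism_apply1)
  have \<Psi>0: "\<Psi> 0 = \<gamma> 0" using gs[OF s(2)] by (simp add: x_def s(3))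
  have "\<Phi> (\<gamma> 0) = 0" using eq[OF s(2)] unfolding x by (simp add: x_def s(3))
  then have V0: "0 \<in> V" using \<Psi>(1) \<gamma>0 by (metis homeomorphism_image1 imageI)
  define D where "D = frechet_derivative \<Psi> (at 0)"
  have Dne: "bracket (D ?e) (D ?f) \<noteq> 0"
  proof -
    have "\<Psi> differentiable at 0" "\<Phi> differentiable at (\<Psi> 0)"
      using \<Psi>(2) \<Phi>s V0 \<gamma>0 \<Psi>0 unfolding smooth_on_def by (metis Ck_on.simps(2))+
    then have D: "(\<Psi> has_derivative D) (at 0)"
      and "(\<Phi> has_derivative frechet_derivative \<Phi> (at (\<Psi> 0))) (at (\<Psi> 0))"
      unfolding D_def using frechet_derivative_works by blast+
    then obtain L where L: "(\<Phi> has_derivative L) (at (\<Psi> 0))" by blast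
    have "((\<lambda>y. \<Phi> (\<Psi> y)) has_derivative (\<lambda>v. L (D v))) (at 0)"
      by (rule has_derivative_compose[OF D L])
    moreover have "((\<lambda>y. \<Phi> (\<Psi> y)) has_derivative (\<lambda>v. v)) (at 0)"
      using homeomorphism_apply2[OF \<Psi>(1)]
      by (intro has_derivative_transform_within_open[OF has_derivative_ident UV(2) V0]) simp
    ultimately have "(\<lambda>v. L (D v)) = (\<lambda>v. v)" by (rule has_derivative_unique)
    then show ?thesis
      using bracket_nonzero_if_linear_image[OF has_derivative_linear[OF L]] by metis
  qed
  let ?c = "\<lambda>k. iter_deriv k \<gamma> 0" and ?q = "taylor_poly 3 s 1"
  define r where "r = coeff ?q"
  have jq: "jet 3 s ?q"
    using jet_taylor_poly[OF J s(2), of 3 s 1] sm by (simp add: smooth_on_def)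
  have q0: "coeff ?q 0 = 0" by (simp add: coeff_taylor_poly iter_deriv_0 s(3))
  have co: "coeff (pcompose (taylor_poly 3 \<gamma> b) ?q) k = coeff [:\<Psi> 0 \<bullet> b, 0, D ?e \<bullet> b, D ?f \<bullet> b:] k"
    if "k \<le> 3" for b k
  proof (rule jet_coeff_unique[OF _ _ _ that])
    show "jet 3 (\<lambda>t. \<gamma> (s t) \<bullet> b) (pcompose (taylor_poly 3 \<gamma> b) ?q)"
      using assms(3) by (intro jet_pcompose jet_taylor_poly[OF assms(1,2)] jq q0)
        (auto simp: smooth_on_def)
    show "jet 3 (\<lambda>t. \<Psi> (t ^ 2 *\<^sub>R ?e + t ^ 3 *\<^sub>R ?f) \<bullet> b) [:\<Psi> 0 \<bullet> b, 0, D ?e \<bullet> b, D ?f \<bullet> b:]"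
      unfolding D_def using \<Psi>(2) by (intro jet_along_cusp[OF UV(2) V0]) (simp add: smooth_on_def)
    have "eventually (\<lambda>t. \<gamma> (s t) \<bullet> b - \<Psi> (t ^ 2 *\<^sub>R ?e + t ^ 3 *\<^sub>R ?f) \<bullet> b = 0) (at 0)"
      using eventually_at_in_open'[OF J s(2)] by eventually_elim (simp add: gs x_def)
    then show "(\<lambda>t. \<gamma> (s t) \<bullet> b - \<Psi> (t ^ 2 *\<^sub>R ?e + t ^ 3 *\<^sub>R ?f) \<bullet> b) \<in> o[at 0](\<lambda>t. t ^ 3)"
      by (subst landau_o.small.in_cong[where g = "\<lambda>_. 0"]) auto
  qed
  note co' = coeff_pcompose_0_left[OF q0, folded r_def]
  have coeffs: "coeff [:a, 0, b, c:] 1 = 0" "coeff [:a, 0, b, c:] 2 = b" "coeff [:a, 0, b, c:] 3 = c"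
    for a b c :: real by (simp_all add: eval_nat_numeral)
  have fact_simps: "fact 2 = (2 :: real)" "fact 3 = (6 :: real)" by (simp_all add: fact_numeral)
  note compare = co' coeffs fact_simps coeff_taylor_poly inner_commute
  have 1: "r 1 *\<^sub>R ?c 1 = 0"
  proof (rule vector_eq_ldot[THEN iffD1], intro allI)
    show "b \<bullet> (r 1 *\<^sub>R ?c 1) = b \<bullet> 0" for b
      using co[of 1 b] by (auto simp: compare simp del: One_nat_def)
  qed
  have 2: "D ?e = r 2 *\<^sub>R ?c 1 + (r 1 ^ 2 / 2) *\<^sub>R ?c 2"
  proof (rule vector_eq_ldot[THEN iffD1], intro allI)
    show "b \<bullet> D ?e = b \<bullet> (r 2 *\<^sub>R ?c 1 + (r 1 ^ 2 / 2) *\<^sub>R ?c 2)" for b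
      using co[of 2 b] by (simp add: compare inner_add_right algebra_simps del: One_nat_def)
  qed
  have 3: "D ?f = r 3 *\<^sub>R ?c 1 + (r 1 * r 2) *\<^sub>R ?c 2 + (r 1 ^ 3 / 6) *\<^sub>R ?c 3"
  proof (rule vector_eq_ldot[THEN iffD1], intro allI)
    show "b \<bullet> D ?f = b \<bullet> (r 3 *\<^sub>R ?c 1 + (r 1 * r 2) *\<^sub>R ?c 2 + (r 1 ^ 3 / 6) *\<^sub>R ?c 3)" for b
      using co[of 3 b] by (simp add: compare inner_add_right algebra_simps del: One_nat_def)
  qed
  \<comment> \<open>Otherwise both images would be multiples of the first derivative of \<open>\<gamma>\<close>.\<close>
  have "r 1 \<noteq> 0"
  proof
    assume "r 1 = 0"
    then have "bracket (D ?e) (D ?f) = 0"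
      unfolding 2 3 by (simp add: bracket_bilinear bracket_self)
    then show False using Dne by simp
  qed
  with 1 show c1: "curve_deriv 1 \<gamma> 0 = 0" by (simp add: curve_deriv_iter)
  then have "bracket (D ?e) (D ?f) = (r 1 ^ 5 / 12) * bracket (?c 2) (?c 3)"
    unfolding 2 3 by (simp add: curve_deriv_iter bracket_bilinear bracket_self eval_nat_numeral)
  then show "bracket (curve_deriv 2 \<gamma> 0) (curve_deriv 3 \<gamma> 0) \<noteq> 0"
    using Dne by (auto simp: curve_deriv_iter)
qed

section \<open>Agreement to fifth order\<close>

lemma affine_cuspidal_curvature_alt:
  "affine_cuspidal_curvature \<gamma> = cusp_numerator (\<lambda>k. curve_deriv k \<gamma> 0)
     / \<bar>bracket (curve_deriv 2 \<gamma> 0) (curve_deriv 3 \<gamma> 0)\<bar> powr (12 / 5)"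
  by (simp add: affine_cuspidal_curvature_def cusp_numerator_def Let_def)

text \<open>Testing \<open>A *v w + v\<close> against \<open>b\<close> is testing \<open>w\<close> against the transposed image of \<open>b\<close>, so the
  affine map costs nothing once jets are available in all directions.\<close>

lemma jet_affine_reparam:
  fixes \<gamma> :: "real \<Rightarrow> real^2" and A :: "real^2^2"
  assumes "open I" "0 \<in> I" "Ck_on 5 I \<gamma>" "curve_deriv 1 \<gamma> 0 = 0"
    and "jet 5 u q" "coeff q 0 = 0"
  obtains p where "jet 5 (\<lambda>t. (A *v \<gamma> (u t) + v) \<bullet> b) p" "coeff p 0 = (A *v \<gamma> 0 + v) \<bullet> b" "coeff p 1 = 0"
    "\<And>k. k \<in> {2..5} \<Longrightarrow> coeff p k = ((A *v reparam_jet (coeff q) (\<lambda>k. curve_deriv k \<gamma> 0) k) \<bullet> b) / fact k"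
proof
  have A: "(A *v w) \<bullet> b = w \<bullet> (b v* A)" for w
    by (metis dot_lmul_matrix inner_commute)
  let ?p = "pcompose (taylor_poly 5 \<gamma> (b v* A)) q + [:v \<bullet> b:]"
  note co = coeff_pcompose_0_left[OF assms(6)]
  show "jet 5 (\<lambda>t. (A *v \<gamma> (u t) + v) \<bullet> b) ?p"
    unfolding inner_add_left A
    by (intro jet_add jet_const jet_pcompose jet_taylor_poly[OF assms(1-3)] assms) simp
  show "coeff ?p 0 = (A *v \<gamma> 0 + v) \<bullet> b"
    using assms(6) by (simp add: coeff_pcompose_0 poly_0_coeff_0[of "taylor_poly 5 \<gamma> (b v* A)"]
        coeff_taylor_poly iter_deriv_0 A inner_add_left)
  show "coeff ?p 1 = 0"
    using assms(4) unfolding coeff_add co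
    by (simp add: coeff_taylor_poly curve_deriv_iter)
  have c1: "iter_deriv 1 \<gamma> 0 = 0" using assms(4) by (simp add: curve_deriv_iter)
  have f: "fact 2 = (2::real)" "fact 3 = (6::real)" "fact 4 = (24::real)" "fact 5 = (120::real)"
    by (simp_all add: fact_numeral)
  have c0: "coeff [:y:] 2 = 0" "coeff [:y:] 3 = 0" "coeff [:y:] 4 = 0" "coeff [:y:] 5 = 0" for y :: real
    by (simp_all add: eval_nat_numeral)
  fix k :: nat assume "k \<in> {2..5}"
  then consider "k = 2" | "k = 3" | "k = 4" | "k = 5" by force
  then show "coeff ?p k = ((A *v reparam_jet (coeff q) (\<lambda>k. curve_deriv k \<gamma> 0) k) \<bullet> b) / fact k"
    by cases (simp_all add: co c0 c1 f A coeff_taylor_poly curve_deriv_iter reparam_jet_simps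
        inner_add_left add_divide_distrib algebra_simps del: One_nat_def)
qed

theorem theorem1p2:
  fixes \<gamma>1 \<gamma>2 :: "real \<Rightarrow> real^2" and I1 I2 :: "real set"
  assumes "open_interval_at_0 I1" and "smooth_on I1 \<gamma>1" and "has_cusp_3_2_at_0 \<gamma>1"
    and "open_interval_at_0 I2" and "smooth_on I2 \<gamma>2" and "has_cusp_3_2_at_0 \<gamma>2"
  shows "affine_cuspidal_curvature \<gamma>1 = affine_cuspidal_curvature \<gamma>2 \<longleftrightarrow>
    (\<exists>(T :: real^2 \<Rightarrow> real^2) (u :: real \<Rightarrow> real) J.
       equi_affine T \<and>
       open_interval_at_0 J \<and> J \<subseteq> I1 \<and> u ` J \<subseteq> I2 \<and>
       smooth_on J u \<and> u 0 = 0 \<and> (\<forall>t\<in>J. deriv u t > 0) \<and>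
       (\<lambda>t. norm (T (\<gamma>2 (u t)) - \<gamma>1 t)) \<in> o[at 0](\<lambda>t. t ^ 5))"
proof -
  have I: "open I1" "0 \<in> I1" "open I2" "0 \<in> I2"
    using assms(1,4) by (auto simp: open_interval_at_0_def)
  have C: "Ck_on n I1 \<gamma>1" "Ck_on n I2 \<gamma>2" for n
    using assms(2,5) by (auto simp: smooth_on_def)
  note c1 = cusp_derivatives[OF I(1,2) assms(2,3)]
  note c2 = cusp_derivatives[OF I(3,4) assms(5,6)]
  define d where "d k = curve_deriv k \<gamma>2 0" for k
  define D where "D k = curve_deriv k \<gamma>1 0" for k
  note \<mu> = affine_cuspidal_curvature_alt[of \<gamma>1, folded D_def] affine_cuspidal_curvature_alt[of \<gamma>2, folded d_def]
  note jet1 = jet_taylor_poly[OF I(1,2) C(1), of 5]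
  note jet2 = jet_affine_reparam[OF I(3,4) C(2) c2(1), folded d_def]
  show ?thesis
  proof
    assume "affine_cuspidal_curvature \<gamma>1 = affine_cuspidal_curvature \<gamma>2"
    then obtain A :: "real^2^2" and a where A: "\<bar>det A\<bar> = 1" and a: "a 1 > 0"
      and DA: "\<And>k. k \<in> {2..5} \<Longrightarrow> D k = A *v reparam_jet a d k"
      using reparam_exists[of d D] c1(2) c2(2) unfolding \<mu> D_def d_def by blast
    define q where "q = [:0, a 1, a 2, a 3, a 4:]"
    have q: "coeff q 0 = 0" "coeff q 1 = a 1" "coeff q 2 = a 2" "coeff q 3 = a 3" "coeff q 4 = a 4"
      by (simp_all add: q_def eval_nat_numeral)
    have ra: "reparam_jet (coeff q) d k = reparam_jet a d k" for k
      by (simp add: reparam_jet_def q del: One_nat_def)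
    define v where "v = \<gamma>1 0 - A *v \<gamma>2 0"
    define T where "T x = A *v x + v" for x
    \<comment> \<open>On \<open>W\<close> the polynomial parameter change has positive derivative and takes values
      in the domain of the second curve.\<close>
    define W where "W = I1 \<inter> poly q -` I2 \<inter> poly (pderiv q) -` {0<..}"
    have "open W" unfolding W_def
      using I by (intro open_Int continuous_open_vimage) (auto intro!: continuous_intros)
    moreover have "0 \<in> W"
      using I a q by (simp add: W_def poly_0_coeff_0 coeff_pderiv)
    ultimately obtain e where e: "e > 0" "ball 0 e \<subseteq> W"
      using openE by blast
    have "(\<lambda>t. norm (T (\<gamma>2 (poly q t)) - \<gamma>1 t)) \<in> o[at 0](\<lambda>t. t ^ 5)"
      unfolding norm_smallo_iff inner_diff_left
    proof
      fix b :: "real^2" assume "b \<in> Basis"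
      obtain p where p: "jet 5 (\<lambda>t. T (\<gamma>2 (poly q t)) \<bullet> b) p" "coeff p 0 = \<gamma>1 0 \<bullet> b" "coeff p 1 = 0"
        "\<And>k. k \<in> {2..5} \<Longrightarrow> coeff p k = (A *v reparam_jet a d k) \<bullet> b / fact k"
        using jet2[OF jet_poly q(1), of A v b] unfolding T_def ra by (auto simp: v_def)
      show "(\<lambda>t. T (\<gamma>2 (poly q t)) \<bullet> b - \<gamma>1 t \<bullet> b) \<in> o[at 0](\<lambda>t. t ^ 5)"
      proof (rule jet_smallo[OF p(1) jet1])
        fix k :: nat assume "k \<le> 5"
        then consider "k = 0" | "k = 1" | "k \<in> {2..5}" by force
        then show "coeff p k = coeff (taylor_poly 5 \<gamma>1 b) k"
        proof cases
          case 3
          then show ?thesis using p(4) DA[OF 3]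
            by (simp add: coeff_taylor_poly D_def curve_deriv_iter)
        qed (use p c1(1) in \<open>simp_all add: coeff_taylor_poly iter_deriv_0 curve_deriv_iter\<close>)
      qed
    qed
    moreover have "deriv (poly q) t = poly (pderiv q) t" for t
      by (rule DERIV_imp_deriv[OF poly_DERIV])
    moreover have "equi_affine T"
      using A unfolding equi_affine_def T_def by blast
    moreover have "open_interval_at_0 (ball 0 e)"
      using e(1) by (simp add: open_interval_at_0_def is_interval_ball_real)
    moreover have "smooth_on (ball 0 e) (poly q)"
      by (simp add: smooth_on_def Ck_on_poly)
    ultimately show "\<exists>T u J. equi_affine T \<and>
       open_interval_at_0 J \<and> J \<subseteq> I1 \<and> u ` J \<subseteq> I2 \<and>
       smooth_on J u \<and> u 0 = 0 \<and> (\<forall>t\<in>J. deriv u t > 0) \<and>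
       (\<lambda>t. norm (T (\<gamma>2 (u t)) - \<gamma>1 t)) \<in> o[at 0](\<lambda>t. t ^ 5)"
      using e(2) q(1) unfolding W_def
      by (intro exI[of _ T] exI[of _ "poly q"] exI[of _ "ball 0 e"]) (auto simp: poly_0_coeff_0)
  next
    assume "\<exists>T u J. equi_affine T \<and>
       open_interval_at_0 J \<and> J \<subseteq> I1 \<and> u ` J \<subseteq> I2 \<and>
       smooth_on J u \<and> u 0 = 0 \<and> (\<forall>t\<in>J. deriv u t > 0) \<and>
       (\<lambda>t. norm (T (\<gamma>2 (u t)) - \<gamma>1 t)) \<in> o[at 0](\<lambda>t. t ^ 5)"
    then obtain T u J where T: "equi_affine T" and J: "open_interval_at_0 J" and us: "smooth_on J u"
      and u: "u 0 = 0" "\<forall>t\<in>J. deriv u t > 0"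
      and o: "(\<lambda>t. norm (T (\<gamma>2 (u t)) - \<gamma>1 t)) \<in> o[at 0](\<lambda>t. t ^ 5)" by blast
    have J0: "open J" "0 \<in> J" using J by (auto simp: open_interval_at_0_def)
    obtain A :: "real^2^2" and v where A: "\<bar>det A\<bar> = 1" and TA: "T = (\<lambda>x. A *v x + v)"
      using T unfolding equi_affine_def by blast
    define q where "q = taylor_poly 5 u 1"
    have q: "jet 5 u q" "coeff q 0 = 0"
      using jet_taylor_poly[OF J0, of 5 u 1] us u
      by (auto simp: q_def smooth_on_def coeff_taylor_poly iter_deriv_0)
    have "(u has_vector_derivative vector_derivative u (at 0)) (at 0)"
      using us J0(2) unfolding smooth_on_def by (metis Ck_on.simps(2) vector_derivative_works)
    then have "deriv u 0 = vector_derivative u (at 0)"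
      by (simp add: DERIV_imp_deriv has_real_derivative_iff_has_vector_derivative)
    then have q1: "coeff q 1 > 0"
      using u(2) J0(2) by (auto simp: q_def coeff_taylor_poly iter_deriv_Suc iter_deriv_0)
    have "D k = A *v reparam_jet (coeff q) d k" if k: "k \<in> {2..5}" for k
    proof (rule euclidean_eqI)
      fix b :: "real^2" assume b: "b \<in> Basis"
      obtain p where p: "jet 5 (\<lambda>t. T (\<gamma>2 (u t)) \<bullet> b) p"
        "\<And>k. k \<in> {2..5} \<Longrightarrow> coeff p k = (A *v reparam_jet (coeff q) d k) \<bullet> b / fact k"
        using jet2[OF q, of A v b] unfolding TA by auto
      have "(\<lambda>t. T (\<gamma>2 (u t)) \<bullet> b - \<gamma>1 t \<bullet> b) \<in> o[at 0](\<lambda>t. t ^ 5)"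
        using o b unfolding norm_smallo_iff inner_diff_left by blast
      from jet_coeff_unique[OF p(1) jet1 this, of k] k p(2)[OF k]
      show "D k \<bullet> b = (A *v reparam_jet (coeff q) d k) \<bullet> b"
        by (simp add: coeff_taylor_poly D_def curve_deriv_iter)
    qed
    then show "affine_cuspidal_curvature \<gamma>1 = affine_cuspidal_curvature \<gamma>2"
      unfolding \<mu> by (rule curvature_reparam[where u = "coeff q", OF A q1])
  qed
qed

end
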